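(* Consider an imprecise probability tree, any extended real variable $f\colon\Omega\to\mathbb{R}\cup\{-\infty,+\infty\}$ and any $n,m\in\mathbb{N}_0$ such that $n\geq m$. Then $$\underline{E}(f|X_{1:m})=\underline{E}\big(\underline{E}(f|X_{1:n})\,\big|\,X_{1:m}\big).$$ That is, for every $z_{1:m}\in\mathcal{X}_{1:m}$, $\underline{E}(f|z_{1:m})=\underline{E}(h|z_{1:m})$, where $h$ is the extended real variable $h(\omega):=\underline{E}(f|\omega^n)$.
   Context: Write $\mathbb{N}=\{1,2,\dots\}$ and $\mathbb{N}_0=\mathbb{N}\cup\{0\}$. For each $k\in\mathbb{N}$ let $\mathcal{X}_k$ be a non-empty finite set. A situation is a finite string $x_{1:n}\in\mathcal{X}_{1:n}:=\mathcal{X}_1\times\dots\times\mathcal{X}_n$ with $n\in\mathbb{N}_0$; the empty string is $\square$. A path is an element $\omega=(\omega_1,\omega_2,\dots)$ of $\Omega:=\prod_{k\in\mathbb{N}}\mathcal{X}_k$; $\omega^n:=(\omega_1,\dots,\omega_n)$. For a situation $s=x_{1:n}$, $\Gamma(s):=\{\omega\in\Omega:\omega^n=x_{1:n}\}$. An extended real variable is a map $\Omega\to\mathbb{R}\cup\{-\infty,+\infty\}$. $X_{1:n}$ denotes the first $n$ states: $X_{1:n}(\omega)=\omega^n$. A gamble on a set $Y$ is a bounded function $Y\to\mathbb{R}$; $\mathcal{G}(Y)$ is the set of these. A lower expectation on $\mathcal{G}(Y)$ is a functional $\underline{E}\colon\mathcal{G}(Y)\to\mathbb{R}$ with $\underline{E}(f)\geq\inf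 f$, $\underline{E}(f+g)\geq\underline{E}(f)+\underline{E}(g)$ and $\underline{E}(\lambda f)=\lambda\underline{E}(f)$ for all gambles $f,g$ and real $\lambda\geq0$. An imprecise probability tree attaches to each situation $x_{1:n}$ a lower expectation $\underline{Q}(\cdot|x_{1:n})$ on $\mathcal{G}(\mathcal{X}_{n+1})$. A real process is a real-valued map $\mathcal{F}$ on situations; $\Delta\mathcal{F}(x_{1:n})(x_{n+1}):=\mathcal{F}(x_{1:n+1})-\mathcal{F}(x_{1:n})$. A submartingale is a real process $\mathcal{M}$ with $\underline{Q}(\Delta\mathcal{M}(s)|s)\geq0$ for all situations $s$. $\limsup\mathcal{M}(\omega):=\limsup_{n\to\infty}\mathcal{M}(\omega^n)$. For an extended real variable $f$ and a situation $s$, the global conditional lower expectation is $$\underline{E}(f|s):=\sup\{\mathcal{M}(s):\mathcal{M}\text{ a bounded above submartingale with }\limsup\mathcal{M}(\omega)\leq f(\omega)\text{ for all }\omega\in\Gamma(s)\},$$ with $\sup\emptyset=-\infty$. *)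

theory Defs
  imports Complex_Main "HOL-Library.Extended_Real" "HOL-Library.Liminf_Limsup" "HOL-Library.FuncSet"
begin

text \<open>
  The state spaces are \<open>X 1, X 2, \<dots>\<close>; the value \<open>X 0\<close> is never used. Entry \<open>i\<close> (counted from 0)
  of a list is the state at time \<open>Suc i\<close>.
\<close>

definition strings :: "(nat \<Rightarrow> 'a set) \<Rightarrow> nat \<Rightarrow> 'a list set" where
  "strings X n = {s. length s = n \<and> (\<forall>i<n. s ! i \<in> X (Suc i))}"

definition situations :: "(nat \<Rightarrow> 'a set) \<Rightarrow> 'a list set" where
  "situations X = (\<Union>n. strings X n)"

definition paths :: "(nat \<Rightarrow> 'a set) \<Rightarrow> (nat \<Rightarrow> 'a) set" where
  "paths X = (\<Pi>\<^sub>E k\<in>{1..}. X k)"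

definition initial :: "(nat \<Rightarrow> 'a) \<Rightarrow> nat \<Rightarrow> 'a list" where
  "initial \<omega> n = map \<omega> [1..<Suc n]"

definition cylinder :: "(nat \<Rightarrow> 'a set) \<Rightarrow> 'a list \<Rightarrow> (nat \<Rightarrow> 'a) set" where
  "cylinder X s = {\<omega> \<in> paths X. initial \<omega> (length s) = s}"

definition gambles :: "'a set \<Rightarrow> ('a \<Rightarrow> real) set" where
  "gambles Y = {f. bdd_below (f ` Y) \<and> bdd_above (f ` Y)}"

text \<open>
  A gamble on \<open>Y\<close> is represented by any total function with these values on \<open>Y\<close>. The axioms force
  a lower expectation to ignore the values outside \<open>Y\<close>, see \<open>lower_expectation_cong\<close> below, so it
  is a functional on the actual gambles on \<open>Y\<close>.
\<close>

definition lower_expectation :: "'a set \<Rightarrow> (('a \<Rightarrow> real) \<Rightarrow> real) \<Rightarrow> bool" where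
  "lower_expectation Y E \<longleftrightarrow>
     (\<forall>f\<in>gambles Y. E f \<ge> (INF y\<in>Y. f y)) \<and>
     (\<forall>f\<in>gambles Y. \<forall>g\<in>gambles Y. E (\<lambda>y. f y + g y) \<ge> E f + E g) \<and>
     (\<forall>f\<in>gambles Y. \<forall>c\<ge>0. E (\<lambda>y. c * f y) = c * E f)"

lemma lower_expectation_cong:
  assumes E: "lower_expectation Y E" and "Y \<noteq> {}"
    and f: "f \<in> gambles Y" and g: "g \<in> gambles Y" and eq: "\<And>y. y \<in> Y \<Longrightarrow> f y = g y"
  shows "E f = E g"
proof -
  have le: "E u \<le> E v"
    if u: "u \<in> gambles Y" and uv: "\<And>y. y \<in> Y \<Longrightarrow> u y = v y" for u v
  proof -
    have im: "(\<lambda>y. v y - u y) ` Y = {0}"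
      using \<open>Y \<noteq> {}\<close> uv by (auto simp: image_iff)
    then have d: "(\<lambda>y. v y - u y) \<in> gambles Y"
      by (simp add: gambles_def)
    then have "E (\<lambda>y. v y - u y) \<ge> (INF y\<in>Y. v y - u y)"
      using E by (auto simp: lower_expectation_def)
    then have "E (\<lambda>y. v y - u y) \<ge> 0"
      by (simp add: im)
    moreover have "E (\<lambda>y. u y + (v y - u y)) \<ge> E u + E (\<lambda>y. v y - u y)"
      using E u d unfolding lower_expectation_def by blast
    ultimately show ?thesis
      by simp
  qed
  show ?thesis
    using le[OF f, of g] le[OF g, of f] eq by force
qed

definition imprecise_probability_tree ::
    "(nat \<Rightarrow> 'a set) \<Rightarrow> ('a list \<Rightarrow> ('a \<Rightarrow> real) \<Rightarrow> real) \<Rightarrow> bool" where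
  "imprecise_probability_tree X Q \<longleftrightarrow>
     (\<forall>s\<in>situations X. lower_expectation (X (Suc (length s))) (Q s))"

definition process_diff :: "('a list \<Rightarrow> real) \<Rightarrow> 'a list \<Rightarrow> 'a \<Rightarrow> real" where
  "process_diff F s x = F (s @ [x]) - F s"

definition submartingale ::
    "(nat \<Rightarrow> 'a set) \<Rightarrow> ('a list \<Rightarrow> ('a \<Rightarrow> real) \<Rightarrow> real) \<Rightarrow> ('a list \<Rightarrow> real) \<Rightarrow> bool" where
  "submartingale X Q M \<longleftrightarrow> (\<forall>s\<in>situations X. Q s (process_diff M s) \<ge> 0)"

text \<open>In \<^typ>\<open>ereal\<close> the supremum of the empty set is \<open>-\<infinity>\<close>.\<close>

definition global_lower_expectation ::
    "(nat \<Rightarrow> 'a set) \<Rightarrow> ('a list \<Rightarrow> ('a \<Rightarrow> real) \<Rightarrow> real) \<Rightarrow>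
     ((nat \<Rightarrow> 'a) \<Rightarrow> ereal) \<Rightarrow> 'a list \<Rightarrow> ereal" where
  "global_lower_expectation X Q f s =
     Sup {ereal (M s) | M. submartingale X Q M \<and> bdd_above (M ` situations X) \<and>
            (\<forall>\<omega>\<in>cylinder X s. limsup (\<lambda>n. ereal (M (initial \<omega> n))) \<le> f \<omega>)}"

end

theory Submission
  imports Defs
begin

text \<open>
  Both inequalities come from splicing processes at time \<open>n\<close>: follow a submartingale \<open>M\<close> up to
  time \<open>n\<close> and, from each situation \<open>t\<close> of length \<open>n\<close> onwards, copy the increments of a submartingale
  \<open>N t\<close>. The result is a submartingale (\<open>submartingale_splice\<close>), and it is bounded above because
  there are only finitely many situations of length \<open>n\<close> (\<open>bdd_above_splice\<close>).

  For \<open>\<le>\<close>, take \<open>M\<close> admissible for \<open>f\<close> at \<open>z\<close> and stop it at time \<open>n\<close> (all \<open>N t\<close> constant). Along a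
  path \<open>\<omega>\<close> through \<open>z\<close> the stopped process is eventually \<open>M\<close> at the situation of \<open>\<omega>\<close> at time \<open>n\<close>,
  where \<open>M\<close> is again admissible for \<open>f\<close>; so its limit is at most the conditional lower expectation
  there.

  For \<open>\<ge>\<close>, take \<open>M\<close> admissible at \<open>z\<close> for the variable \<open>h\<close> that maps \<open>\<omega>\<close> to the conditional lower
  expectation of \<open>f\<close> in the situation of \<open>\<omega>\<close> at time \<open>n\<close>. From any situation \<open>t\<close> of length \<open>n\<close> after
  \<open>z\<close> there is a path along which \<open>M\<close> never decreases (\<open>submartingale_nondecreasing_path\<close>); since
  \<open>h\<close> is constant on the cylinder of \<open>t\<close>, the value \<open>M t\<close> is at most the conditional lower expectation
  of \<open>f\<close> at \<open>t\<close>. Hence, for \<open>\<epsilon> > 0\<close>, some \<open>N t\<close> admissible for \<open>f\<close> at \<open>t\<close> has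
  \<open>N t t > M t - \<epsilon>\<close>. Splicing \<open>M - \<epsilon>\<close> with these \<open>N t\<close> gives a process that lies below \<open>N t\<close>
  after \<open>t\<close>, so it is admissible for \<open>f\<close> at \<open>z\<close>, with value \<open>M z - \<epsilon>\<close> there.
\<close>

section \<open>Situations and cylinders\<close>

lemma length_initial [simp]: "length (initial \<omega> n) = n"
  by (simp add: initial_def)

lemma take_initial: "m \<le> n \<Longrightarrow> take m (initial \<omega> n) = initial \<omega> m"
  by (rule nth_equalityI) (auto simp: initial_def simp del: upt_Suc)

lemma initial_in_strings: "\<omega> \<in> paths X \<Longrightarrow> initial \<omega> n \<in> strings X n"
  by (auto simp: strings_def initial_def paths_def PiE_def Pi_def simp del: upt_Suc)

lemma strings_subset_situations: "strings X n \<subseteq> situations X"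
  by (auto simp: situations_def)

lemma situationsE:
  assumes "s \<in> situations X"
  shows "s \<in> strings X (length s)"
  using assms by (auto simp: situations_def strings_def)

lemma take_in_strings: "s \<in> situations X \<Longrightarrow> n \<le> length s \<Longrightarrow> take n s \<in> strings X n"
  by (auto simp: situations_def strings_def)

lemma append_in_situations:
  "s \<in> situations X \<Longrightarrow> x \<in> X (Suc (length s)) \<Longrightarrow> s @ [x] \<in> situations X"
  by (auto simp: situations_def strings_def nth_append less_Suc_eq)

lemma finite_strings:
  assumes "\<And>k. k \<ge> 1 \<Longrightarrow> finite (X k)"
  shows "finite (strings X n)"
proof (rule finite_subset)
  show "strings X n \<subseteq> {s. set s \<subseteq> (\<Union>i<n. X (Suc i)) \<and> length s = n}"
    by (fastforce simp: strings_def in_set_conv_nth)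
  show "finite {s. set s \<subseteq> (\<Union>i<n. X (Suc i)) \<and> length s = n}"
    using assms by (intro finite_lists_length_eq) auto
qed

text \<open>The cylinder of a later situation on the path lies inside that of an earlier one.\<close>

lemma cylinder_initial_subset:
  assumes "\<omega> \<in> cylinder X z" and "length z \<le> n"
  shows "cylinder X (initial \<omega> n) \<subseteq> cylinder X z"
proof
  fix \<omega>' assume "\<omega>' \<in> cylinder X (initial \<omega> n)"
  then have "\<omega>' \<in> paths X" and "initial \<omega>' n = initial \<omega> n"
    by (auto simp: cylinder_def)
  moreover from this(2) have "initial \<omega>' (length z) = initial \<omega> (length z)"
    using take_initial[OF assms(2)] by metis
  ultimately show "\<omega>' \<in> cylinder X z"
    using assms(1) by (simp add: cylinder_def)
qed

section \<open>Submartingales and nondecreasing paths\<close>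

lemma lower_expectation_zero:
  assumes "lower_expectation Y E"
  shows "E (\<lambda>_. 0) = 0"
proof -
  have zero: "(\<lambda>_. 0) \<in> gambles Y"
    by (auto simp: gambles_def)
  have "\<forall>f\<in>gambles Y. \<forall>c\<ge>0. E (\<lambda>y. c * f y) = c * E f"
    using assms by (simp add: lower_expectation_def)
  from bspec[OF this zero, rule_format, of 0] show ?thesis
    by simp
qed

text \<open>A lower expectation is at most the maximum of the gamble, by superadditivity on \<open>g + (- g) = 0\<close>.\<close>

lemma lower_expectation_nonneg_imp_ex:
  assumes E: "lower_expectation Y E" and Y: "finite Y" "Y \<noteq> {}" and nonneg: "E g \<ge> 0"
  obtains y where "y \<in> Y" and "g y \<ge> 0"
proof -
  have gambles: "u \<in> gambles Y" for u
    using Y by (simp add: gambles_def)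
  have "E (\<lambda>y. g y + - g y) \<ge> E g + E (\<lambda>y. - g y)"
    using E gambles unfolding lower_expectation_def by blast
  then have "E (\<lambda>y. - g y) \<le> 0"
    using nonneg lower_expectation_zero[OF E] by simp
  moreover have "E (\<lambda>y. - g y) \<ge> (INF y\<in>Y. - g y)"
    using E gambles unfolding lower_expectation_def by blast
  moreover have "(INF y\<in>Y. - g y) \<in> (\<lambda>y. - g y) ` Y"
    using Y by (metis Min_in cInf_eq_Min finite_imageI image_is_empty)
  ultimately show thesis
    using that by force
qed

lemma submartingale_const:
  assumes "imprecise_probability_tree X Q"
  shows "submartingale X Q (\<lambda>_. c)"
  using assms
  by (auto simp: submartingale_def process_diff_def[abs_def] imprecise_probability_tree_def
      lower_expectation_zero)

text \<open>
  By \<open>lower_expectation_nonneg_imp_ex\<close>, every situation has a next state that does not decrease \<open>M\<close>;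
  always moving to such a state gives the path.
\<close>

lemma submartingale_nondecreasing_path:
  assumes fin: "\<And>k. k \<ge> 1 \<Longrightarrow> finite (X k)"
    and ne: "\<And>k. k \<ge> 1 \<Longrightarrow> X k \<noteq> {}"
    and tree: "imprecise_probability_tree X Q"
    and M: "submartingale X Q M"
    and t: "t \<in> situations X"
  obtains \<omega> where "\<omega> \<in> cylinder X t" and "\<And>j. j \<ge> length t \<Longrightarrow> M t \<le> M (initial \<omega> j)"
proof -
  have "\<exists>x. x \<in> X (Suc (length s)) \<and> M s \<le> M (s @ [x])" if s: "s \<in> situations X" for s
  proof -
    have "lower_expectation (X (Suc (length s))) (Q s)" "Q s (process_diff M s) \<ge> 0"
      using s tree M by (auto simp: imprecise_probability_tree_def submartingale_def)
    then obtain x where "x \<in> X (Suc (length s))" "process_diff M s x \<ge> 0"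
      using lower_expectation_nonneg_imp_ex fin[of "Suc (length s)"] ne[of "Suc (length s)"]
      by (metis le_add1 plus_1_eq_Suc)
    then show ?thesis
      by (auto simp: process_diff_def)
  qed
  then obtain nxt where nxt: "nxt s \<in> X (Suc (length s))" "M s \<le> M (s @ [nxt s])"
    if "s \<in> situations X" for s
    by metis
  define g where "g k = ((\<lambda>s. s @ [nxt s]) ^^ k) t" for k
  have g_0: "g 0 = t" and g_Suc: "g (Suc k) = g k @ [nxt (g k)]" for k
    by (simp_all add: g_def)
  have length_g: "length (g k) = length t + k" for k
    by (induction k) (simp_all add: g_0 g_Suc)
  have g_sit: "g k \<in> situations X" for k
    by (induction k) (simp_all add: g_0 g_Suc t append_in_situations nxt)
  have M_g: "M t \<le> M (g k)" for k
  proof (induction k)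
    case (Suc k)
    then show ?case
      using nxt(2)[OF g_sit[of k]] by (simp add: g_Suc)
  qed (simp add: g_0)
  have nth_g: "g k ! i = g l ! i" if "k \<le> l" "i < length t + k" for i k l
    using that by (induction l rule: dec_induct) (auto simp: g_Suc nth_append length_g)
  \<comment> \<open>Entry \<open>i\<close> of a string is the state at time \<open>Suc i\<close>, and \<open>g i\<close> is long enough to contain the
    state at time \<open>i\<close>; a path is undefined at time 0.\<close>
  define \<omega> where "\<omega> i = (if i = 0 then undefined else g i ! (i - 1))" for i
  have initial_\<omega>: "initial \<omega> (length t + k) = g k" for k
  proof (rule nth_equalityI)
    fix i assume "i < length (initial \<omega> (length t + k))"
    then have i: "i < length t + k"
      by simp
    then have "initial \<omega> (length t + k) ! i = g (Suc i) ! i"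
      by (simp add: initial_def \<omega>_def del: upt_Suc)
    also have "\<dots> = g k ! i"
    proof (cases "k \<le> Suc i")
      case True
      then show ?thesis
        using i by (rule nth_g[symmetric])
    next
      case False
      then show ?thesis
        by (intro nth_g) auto
    qed
    finally show "initial \<omega> (length t + k) ! i = g k ! i" .
  qed (simp add: length_g)
  have "\<omega> i \<in> X i" if "i \<ge> 1" for i
    using situationsE[OF g_sit[of i]] that
    by (cases i) (auto simp: \<omega>_def strings_def length_g)
  then have "\<omega> \<in> paths X"
    by (auto simp: paths_def \<omega>_def Suc_le_eq split: if_splits)
  then have "\<omega> \<in> cylinder X t"
    using initial_\<omega>[of 0] by (simp add: cylinder_def g_0)
  moreover have "M t \<le> M (initial \<omega> j)" if "j \<ge> length t" for j
    using initial_\<omega>[of "j - length t"] that M_g by simp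
  ultimately show thesis
    using that by blast
qed

section \<open>Splicing submartingales\<close>

text \<open>
  The process that follows \<open>M\<close> up to time \<open>n\<close> and then, beyond each situation \<open>t\<close> of length \<open>n\<close>, has
  the increments of \<open>N t\<close>. At length \<open>n\<close> both descriptions give the value of \<open>M\<close>.
\<close>

definition splice_process ::
    "nat \<Rightarrow> ('a list \<Rightarrow> real) \<Rightarrow> ('a list \<Rightarrow> 'a list \<Rightarrow> real) \<Rightarrow> 'a list \<Rightarrow> real" where
  "splice_process n M N s =
     (if length s < n then M s
      else M (take n s) + (N (take n s) s - N (take n s) (take n s)))"

lemma splice_process_before: "length s \<le> n \<Longrightarrow> splice_process n M N s = M s"
  by (auto simp: splice_process_def)

lemma submartingale_splice:
  assumes M: "submartingale X Q M"
    and N: "\<And>t. t \<in> strings X n \<Longrightarrow> submartingale X Q (N t)"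
  shows "submartingale X Q (splice_process n M N)"
  unfolding submartingale_def
proof
  fix s assume s: "s \<in> situations X"
  show "Q s (process_diff (splice_process n M N) s) \<ge> 0"
  proof (cases "length s < n")
    case True
    then have "process_diff (splice_process n M N) s = process_diff M s"
      by (auto simp: process_diff_def splice_process_before)
    then show ?thesis
      using M s by (simp add: submartingale_def)
  next
    case False
    then have "process_diff (splice_process n M N) s = process_diff (N (take n s)) s"
      by (auto simp: process_diff_def splice_process_def)
    moreover have "take n s \<in> strings X n"
      using False s by (simp add: take_in_strings)
    ultimately show ?thesis
      using N s by (simp add: submartingale_def)
  qed
qed

lemma bdd_above_splice:
  assumes fin: "\<And>k. k \<ge> 1 \<Longrightarrow> finite (X k)"
    and M: "bdd_above (M ` situations X)"
    and N: "\<And>t. t \<in> strings X n \<Longrightarrow> bdd_above (N t ` situations X)"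
  shows "bdd_above (splice_process n M N ` situations X)"
proof -
  define B where "B t = (\<lambda>s. M t + (N t s - N t t)) ` situations X" for t
  have "bdd_above (B t)" if t: "t \<in> strings X n" for t
  proof -
    obtain b where "\<And>s. s \<in> situations X \<Longrightarrow> N t s \<le> b"
      using N[OF t] by (auto simp: bdd_above_def)
    then show ?thesis
      unfolding B_def by (intro bdd_aboveI2[where M = "M t + (b - N t t)"]) simp
  qed
  then have "bdd_above (M ` situations X \<union> (\<Union>t\<in>strings X n. B t))"
    using M finite_strings[OF fin] by simp
  moreover have "splice_process n M N s \<in> M ` situations X \<union> (\<Union>t\<in>strings X n. B t)"
    if s: "s \<in> situations X" for s
  proof (cases "length s < n")
    case False
    then have "take n s \<in> strings X n" "splice_process n M N s \<in> B (take n s)"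
      using s by (auto simp: splice_process_def B_def take_in_strings)
    then show ?thesis
      by blast
  qed (use s in \<open>simp add: splice_process_def\<close>)
  then have "splice_process n M N ` situations X
      \<subseteq> M ` situations X \<union> (\<Union>t\<in>strings X n. B t)"
    by blast
  ultimately show ?thesis
    by (rule bdd_above_mono)
qed

section \<open>Iterated lower expectations\<close>

lemma global_lower_expectation_upper:
  assumes "submartingale X Q M" and "bdd_above (M ` situations X)"
    and "\<And>\<omega>. \<omega> \<in> cylinder X s \<Longrightarrow> limsup (\<lambda>n. ereal (M (initial \<omega> n))) \<le> f \<omega>"
  shows "ereal (M s) \<le> global_lower_expectation X Q f s"
  unfolding global_lower_expectation_def by (rule Sup_upper) (use assms in auto)

lemma global_lower_expectation_least:
  assumes "\<And>M. submartingale X Q M \<Longrightarrow> bdd_above (M ` situations X) \<Longrightarrow>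
      (\<And>\<omega>. \<omega> \<in> cylinder X s \<Longrightarrow> limsup (\<lambda>n. ereal (M (initial \<omega> n))) \<le> f \<omega>) \<Longrightarrow>
      ereal (M s) \<le> c"
  shows "global_lower_expectation X Q f s \<le> c"
  unfolding global_lower_expectation_def by (rule Sup_least) (use assms in auto)

lemma less_global_lower_expectationE:
  assumes "c < global_lower_expectation X Q f s"
  obtains M where "submartingale X Q M" and "bdd_above (M ` situations X)"
    and "\<And>\<omega>. \<omega> \<in> cylinder X s \<Longrightarrow> limsup (\<lambda>n. ereal (M (initial \<omega> n))) \<le> f \<omega>"
    and "c < ereal (M s)"
  using assms unfolding global_lower_expectation_def less_Sup_iff by auto

lemma global_lower_expectation_le_iterated:
  assumes fin: "\<And>k. k \<ge> 1 \<Longrightarrow> finite (X k)"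
    and tree: "imprecise_probability_tree X Q"
    and n: "length z \<le> n"
  shows "global_lower_expectation X Q f z
    \<le> global_lower_expectation X Q (\<lambda>\<omega>. global_lower_expectation X Q f (initial \<omega> n)) z"
    (is "_ \<le> ?R")
proof (rule global_lower_expectation_least)
  fix M
  assume M: "submartingale X Q M" "bdd_above (M ` situations X)"
    and lim: "\<And>\<omega>. \<omega> \<in> cylinder X z \<Longrightarrow> limsup (\<lambda>n. ereal (M (initial \<omega> n))) \<le> f \<omega>"
  let ?S = "splice_process n M (\<lambda>_ _. 0)"
  have "ereal (?S z) \<le> ?R"
  proof (rule global_lower_expectation_upper)
    show "submartingale X Q ?S"
      using M(1) submartingale_const[OF tree] by (rule submartingale_splice)
    show "bdd_above (?S ` situations X)"
      using fin M(2) by (rule bdd_above_splice) auto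
    fix \<omega> assume \<omega>: "\<omega> \<in> cylinder X z"
    have "limsup (\<lambda>j. ereal (?S (initial \<omega> j))) = limsup (\<lambda>j. ereal (M (initial \<omega> n)))"
      by (intro Limsup_eq eventually_sequentiallyI[of n])
        (simp add: splice_process_def take_initial)
    also have "\<dots> = ereal (M (initial \<omega> n))"
      by (simp add: Limsup_const)
    also have "\<dots> \<le> global_lower_expectation X Q f (initial \<omega> n)"
      using M lim cylinder_initial_subset[OF \<omega> n]
      by (intro global_lower_expectation_upper) auto
    finally show "limsup (\<lambda>j. ereal (?S (initial \<omega> j)))
        \<le> global_lower_expectation X Q f (initial \<omega> n)" .
  qed
  then show "ereal (M z) \<le> ?R"
    using n by (simp add: splice_process_before)
qed

lemma iterated_le_global_lower_expectation:
  assumes fin: "\<And>k. k \<ge> 1 \<Longrightarrow> finite (X k)"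
    and ne: "\<And>k. k \<ge> 1 \<Longrightarrow> X k \<noteq> {}"
    and tree: "imprecise_probability_tree X Q"
    and n: "length z \<le> n"
  shows "global_lower_expectation X Q (\<lambda>\<omega>. global_lower_expectation X Q f (initial \<omega> n)) z
    \<le> global_lower_expectation X Q f z"
proof (rule global_lower_expectation_least)
  fix M
  assume M: "submartingale X Q M" "bdd_above (M ` situations X)"
    and lim: "\<And>\<omega>. \<omega> \<in> cylinder X z \<Longrightarrow>
      limsup (\<lambda>j. ereal (M (initial \<omega> j))) \<le> global_lower_expectation X Q f (initial \<omega> n)"
  have M_le: "ereal (M (initial \<omega> n)) \<le> global_lower_expectation X Q f (initial \<omega> n)"
    if \<omega>: "\<omega> \<in> cylinder X z" for \<omega>
  proof -
    let ?t = "initial \<omega> n"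
    have "?t \<in> situations X"
      using \<omega> initial_in_strings[of \<omega> X n] strings_subset_situations[of X n]
      by (auto simp: cylinder_def)
    then obtain \<omega>' where \<omega>': "\<omega>' \<in> cylinder X ?t"
      and up: "\<And>j. j \<ge> length ?t \<Longrightarrow> M ?t \<le> M (initial \<omega>' j)"
      using submartingale_nondecreasing_path[OF fin ne tree M(1)] by metis
    have "ereal (M ?t) = limsup (\<lambda>j. ereal (M ?t))"
      by (simp add: Limsup_const)
    also have "\<dots> \<le> limsup (\<lambda>j. ereal (M (initial \<omega>' j)))"
      using up by (intro Limsup_mono eventually_sequentiallyI[of n]) simp
    also have "\<dots> \<le> global_lower_expectation X Q f (initial \<omega>' n)"
      using lim \<omega>' cylinder_initial_subset[OF \<omega> n] by blast
    also have "initial \<omega>' n = ?t"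
      using \<omega>' by (simp add: cylinder_def)
    finally show ?thesis .
  qed
  have "ereal (M z) \<le> global_lower_expectation X Q f z + ereal \<epsilon>" if \<epsilon>: "\<epsilon> > 0" for \<epsilon>
  proof -
    \<comment> \<open>Nothing is required of \<open>N t\<close> at \<open>t\<close> unless some path through \<open>z\<close> also passes through \<open>t\<close>;
      otherwise any bounded above submartingale will do.\<close>
    have "\<exists>N. submartingale X Q N \<and> bdd_above (N ` situations X) \<and>
        (\<forall>\<omega>\<in>cylinder X z. initial \<omega> n = t \<longrightarrow>
          M t - \<epsilon> < N t \<and> limsup (\<lambda>j. ereal (N (initial \<omega> j))) \<le> f \<omega>)" for t
    proof (cases "\<exists>\<omega>\<in>cylinder X z. initial \<omega> n = t")
      case True
      then have "ereal (M t) \<le> global_lower_expectation X Q f t"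
        using M_le by auto
      then have "ereal (M t - \<epsilon>) < global_lower_expectation X Q f t"
        using \<epsilon> by (elim less_le_trans[rotated]) simp
      then obtain N where "submartingale X Q N" "bdd_above (N ` situations X)"
        "\<And>\<omega>. \<omega> \<in> cylinder X t \<Longrightarrow> limsup (\<lambda>j. ereal (N (initial \<omega> j))) \<le> f \<omega>"
        "ereal (M t - \<epsilon>) < ereal (N t)"
        by (rule less_global_lower_expectationE) auto
      then show ?thesis
        by (intro exI[of _ N]) (auto simp: cylinder_def)
    next
      case False
      then show ?thesis
        using submartingale_const[OF tree, of 0] by (intro exI[of _ "\<lambda>_. 0"]) auto
    qed
    then obtain N where N: "\<And>t. submartingale X Q (N t)" "\<And>t. bdd_above (N t ` situations X)"
      and N_gt: "\<And>\<omega>. \<omega> \<in> cylinder X z \<Longrightarrow>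
        M (initial \<omega> n) - \<epsilon> < N (initial \<omega> n) (initial \<omega> n)"
      and N_lim: "\<And>\<omega>. \<omega> \<in> cylinder X z \<Longrightarrow>
        limsup (\<lambda>j. ereal (N (initial \<omega> n) (initial \<omega> j))) \<le> f \<omega>"
      by metis
    let ?M = "\<lambda>s. M s - \<epsilon>"
    let ?S = "splice_process n ?M N"
    have "process_diff ?M = process_diff M"
      by (simp add: process_diff_def fun_eq_iff)
    then have sub: "submartingale X Q ?M"
      using M(1) by (simp add: submartingale_def)
    have bdd: "bdd_above (?M ` situations X)"
    proof -
      obtain b where "\<And>s. s \<in> situations X \<Longrightarrow> M s \<le> b"
        using M(2) by (auto simp: bdd_above_def)
      then show ?thesis
        by (intro bdd_aboveI2[where M = "b - \<epsilon>"]) simp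
    qed
    have "ereal (?S z) \<le> global_lower_expectation X Q f z"
    proof (rule global_lower_expectation_upper)
      show "submartingale X Q ?S"
        using sub N(1) by (rule submartingale_splice)
      show "bdd_above (?S ` situations X)"
        using fin bdd N(2) by (rule bdd_above_splice)
      fix \<omega> assume \<omega>: "\<omega> \<in> cylinder X z"
      have "limsup (\<lambda>j. ereal (?S (initial \<omega> j)))
          \<le> limsup (\<lambda>j. ereal (N (initial \<omega> n) (initial \<omega> j)))"
        using N_gt[OF \<omega>] by (intro Limsup_mono eventually_sequentiallyI[of n])
          (simp add: splice_process_def take_initial)
      also have "\<dots> \<le> f \<omega>"
        using \<omega> by (rule N_lim)
      finally show "limsup (\<lambda>j. ereal (?S (initial \<omega> j))) \<le> f \<omega>" .
    qed
    then have "ereal (M z - \<epsilon>) \<le> global_lower_expectation X Q f z"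
      using n by (simp add: splice_process_before)
    then have "ereal (M z - \<epsilon>) + ereal \<epsilon> \<le> global_lower_expectation X Q f z + ereal \<epsilon>"
      by (rule add_right_mono)
    then show ?thesis
      by simp
  qed
  then show "ereal (M z) \<le> global_lower_expectation X Q f z"
    by (rule ereal_le_epsilon2)
qed

theorem theorem16:
  fixes X :: "nat \<Rightarrow> 'a set"
    and Q :: "'a list \<Rightarrow> ('a \<Rightarrow> real) \<Rightarrow> real"
    and f :: "(nat \<Rightarrow> 'a) \<Rightarrow> ereal"
    and m n :: nat
  assumes "\<And>k. k \<ge> 1 \<Longrightarrow> finite (X k)"
    and "\<And>k. k \<ge> 1 \<Longrightarrow> X k \<noteq> {}"
    and "imprecise_probability_tree X Q"
    and "n \<ge> m"
  shows "\<forall>z\<in>strings X m.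
           global_lower_expectation X Q f z =
           global_lower_expectation X Q (\<lambda>\<omega>. global_lower_expectation X Q f (initial \<omega> n)) z"
proof
  fix z assume "z \<in> strings X m"
  then have "length z \<le> n"
    using assms(4) by (simp add: strings_def)
  then show "global_lower_expectation X Q f z =
      global_lower_expectation X Q (\<lambda>\<omega>. global_lower_expectation X Q f (initial \<omega> n)) z"
    using assms(1-3)
    by (intro antisym global_lower_expectation_le_iterated iterated_le_global_lower_expectation)
qed

end
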